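(* Let $f(x;\mu)$ be a regular natural exponential family with $\mu$ the mean parametrization, and let $$g(x;\mu,\lambda)=f(x;\mu)+\sum_{k=2}^{r}\lambda_k f^{(k)}(x;\mu),\qquad \lambda=(\lambda_2,\dots,\lambda_r),$$ be its local mixture model of order $r$. Then the local mixture model $g(x;\mu,\lambda)$ is identified in all its parameters, i.e. if $g(\cdot;\mu,\lambda)=g(\cdot;\mu',\lambda')$ as functions in $L^2(\nu)$, then $(\mu,\lambda)=(\mu',\lambda')$. Furthermore, if the variance function $V_f(\mu)$ is a polynomial in $\mu$ of degree at most $2$, then the $(\mu,\lambda)$ parametrization is orthogonal at $\lambda=0$: for every $\mu$ and every $k=2,\dots,r$, $$\int \left.\frac{\partial \log g(x;\mu,\lambda)}{\partial\mu}\right|_{\lambda=0}\left.\frac{\partial \log g(x;\mu,\lambda)}{\partial\lambda_k}\right|_{\lambda=0} f(x;\mu)\,\nu(\mathrm{d}x)=0 .$$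
   Context: A univariate natural exponential family on $\mathbf{R}$ with respect to a $\sigma$-finite measure $\nu$ has densities $\exp\{\theta x-k_\nu(\theta)\}$ with respect to $\nu$, with natural parameter $\theta$. The mean parametrization is $\mu=\mathrm{E}_\theta(X)$, and $f(x;\mu)$ denotes the density (with respect to $\nu$) expressed in terms of $\mu$. Write $f^{(k)}(x;\mu)=\frac{\partial^k}{\partial\mu^k}f(x;\mu)$. Standing regularity: usual regularity conditions on the parametric family are assumed (smoothness in the parameter, interchange of differentiation in $\mu$ and integration in $x$), under which $f(\cdot;\mu)\in L^2(\nu)$ with $\int f\,\mathrm{d}\nu=1$, and all $\mu$-derivatives $f^{(k)}(\cdot;\mu)$ lie in $L^2(\nu)$ and integrate to $0$. The variance function is $V_f(\mu)=\int (x-\mu)^2 f(x;\mu)\,\nu(\mathrm{d}x)$. The parameter $\mu$ is the interest parameter and $\lambda$ the nuisance parameter; orthogonality means vanishing Fisher information between the interest parameter and each nuisance parameter.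
   Formalization: Identification is stated only when ν is not concentrated on r or fewer points; otherwise it fails (for Bernoulli with r=2, f^(2)=0, so λ_2 is not identified). Orthogonality has no such restriction. *)

theory Defs
  imports "HOL-Probability.Probability" "HOL-Computational_Algebra.Polynomial"
begin

definition nat_params :: "real measure \<Rightarrow> real set" where
  "nat_params \<nu> = {\<theta>. integrable \<nu> (\<lambda>x. exp (\<theta> * x))}"

definition cumulant :: "real measure \<Rightarrow> real \<Rightarrow> real" where
  "cumulant \<nu> \<theta> = ln (LINT x|\<nu>. exp (\<theta> * x))"

definition nat_density :: "real measure \<Rightarrow> real \<Rightarrow> real \<Rightarrow> real" where
  "nat_density \<nu> x \<theta> = exp (\<theta> * x - cumulant \<nu> \<theta>)"

definition mean_of :: "real measure \<Rightarrow> real \<Rightarrow> real" where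
  "mean_of \<nu> \<theta> = (LINT x|\<nu>. x * nat_density \<nu> x \<theta>)"

definition mean_domain :: "real measure \<Rightarrow> real set" where
  "mean_domain \<nu> = mean_of \<nu> ` nat_params \<nu>"

text \<open>The density \<open>f(x;\<mu>)\<close>. It is meaningful for \<open>\<mu>\<close> in the mean domain of a non-degenerate
  family; there \<^term>\<open>mean_of \<nu>\<close> is injective on \<^term>\<open>nat_params \<nu>\<close>.\<close>

definition mean_density :: "real measure \<Rightarrow> real \<Rightarrow> real \<Rightarrow> real" where
  "mean_density \<nu> x \<mu> = nat_density \<nu> x (the_inv_into (nat_params \<nu>) (mean_of \<nu>) \<mu>)"

definition mean_density_deriv :: "real measure \<Rightarrow> nat \<Rightarrow> real \<Rightarrow> real \<Rightarrow> real" where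
  "mean_density_deriv \<nu> k x = (deriv ^^ k) (mean_density \<nu> x)"

definition variance_function :: "real measure \<Rightarrow> real \<Rightarrow> real" where
  "variance_function \<nu> \<mu> = (LINT x|\<nu>. (x - \<mu>)\<^sup>2 * mean_density \<nu> x \<mu>)"

definition in_L2 :: "'a measure \<Rightarrow> ('a \<Rightarrow> real) \<Rightarrow> bool" where
  "in_L2 M h \<longleftrightarrow> h \<in> borel_measurable M \<and> integrable M (\<lambda>x. (h x)\<^sup>2)"

definition concentrated_on_at_most :: "nat \<Rightarrow> 'a measure \<Rightarrow> bool" where
  "concentrated_on_at_most n M \<longleftrightarrow> (\<exists>S. finite S \<and> card S \<le> n \<and> (AE x in M. x \<in> S))"

text \<open>Regularity in the usual sense for exponential families: the full natural parameter space is
  open, so smoothness in \<open>\<mu>\<close> and differentiation under the integral sign need not be assumed.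
  Square integrability with respect to \<open>\<nu>\<close> does not follow and is a separate assumption.\<close>

locale regular_nef = sigma_finite_measure \<nu> for \<nu> :: "real measure" +
  assumes sets_borel: "sets \<nu> = sets borel"
    and nondegenerate: "\<not> concentrated_on_at_most 1 \<nu>"
    and nat_params_nonempty: "nat_params \<nu> \<noteq> {}"
    and open_nat_params: "open (nat_params \<nu>)"
    and square_integrable:
      "\<And>k \<mu>. \<mu> \<in> mean_domain \<nu> \<Longrightarrow> in_L2 \<nu> (\<lambda>x. mean_density_deriv \<nu> k x \<mu>)"

text \<open>The nuisance parameter \<open>(\<lambda>\<^sub>2, \<dots>, \<lambda>\<^sub>r)\<close> is a function on \<^typ>\<open>nat\<close>
  of which only the values at \<open>2, \<dots>, r\<close> matter.\<close>

definition local_mixture :: "real measure \<Rightarrow> nat \<Rightarrow> real \<Rightarrow> real \<Rightarrow> (nat \<Rightarrow> real) \<Rightarrow> real" where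
  "local_mixture \<nu> r x \<mu> l = mean_density \<nu> x \<mu> + (\<Sum>k=2..r. l k * mean_density_deriv \<nu> k x \<mu>)"

end

theory Submission
  imports Defs
begin

text \<open>Every \<open>\<mu>\<close>-derivative of the density is \<open>e\<^bsup>\<theta>x\<^esup>\<close> times a polynomial of degree exactly \<open>k\<close> in \<open>x\<close>
  whose coefficients are smooth in \<open>\<theta>\<close>, so its integrals against powers of \<open>x\<close> are finite sums of
  moments and can be differentiated in \<open>\<mu>\<close>. Differentiating \<open>\<integral> f = 1\<close> and \<open>\<integral> x f = \<mu>\<close> shows that
  \<open>f\<^sup>(\<^sup>k\<^sup>)\<close> has mass and first moment \<open>0\<close> for \<open>k \<ge> 2\<close>. Hence the local mixture has mean \<open>\<mu>\<close>, which
  identifies \<open>\<mu>\<close>; for fixed \<open>\<mu>\<close>, two weight vectors giving the same mixture differ by the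
  coefficients of a polynomial of degree at most \<open>r\<close> vanishing almost everywhere. The score in \<open>\<mu>\<close>
  is \<open>(x - \<mu>) / V\<close>, so its information with \<open>\<lambda>\<^sub>k\<close> is \<open>\<integral> (x - \<mu>) f\<^sup>(\<^sup>k\<^sup>) / V = 0\<close>.\<close>

section \<open>Growth bounds for powers and exponentials\<close>

text \<open>Raise d |x| <= exp(d |x|) to the n-th power, with d chosen so small that n d <=
  e.\<close>

lemma abs_power_le_exp:
  fixes e :: real
  assumes "e > 0"
  obtains C where "C \<ge> 0" "\<And>x :: real. \<bar>x\<bar> ^ n \<le> C * exp (e * \<bar>x\<bar>)"
proof
  \<comment> \<open>Dividing by \<open>Suc n\<close> instead of n also covers n = 0.\<close>
  define d where "d = e / real (Suc n)"
  have "d > 0"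
    using assms by (simp add: d_def)
  show "(1 / d) ^ n \<ge> 0"
    using \<open>d > 0\<close> by simp
  fix x :: real
  have "d * \<bar>x\<bar> \<le> exp (d * \<bar>x\<bar>)"
    using exp_ge_add_one_self[of "d * \<bar>x\<bar>"] by linarith
  then have "\<bar>x\<bar> \<le> (1 / d) * exp (d * \<bar>x\<bar>)"
    using \<open>d > 0\<close> by (simp add: field_simps)
  then have "\<bar>x\<bar> ^ n \<le> ((1 / d) * exp (d * \<bar>x\<bar>)) ^ n"
    by (rule power_mono) simp
  also have "\<dots> = (1 / d) ^ n * exp (real n * (d * \<bar>x\<bar>))"
    by (simp only: power_mult_distrib exp_of_nat_mult)
  also have "\<dots> \<le> (1 / d) ^ n * exp (e * \<bar>x\<bar>)"
  proof -
    have "real n * d \<le> e"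
      using assms by (simp add: d_def field_simps)
    then have "real n * (d * \<bar>x\<bar>) \<le> e * \<bar>x\<bar>"
      using mult_right_mono[of "real n * d" e "\<bar>x\<bar>"] by (simp add: mult.assoc)
    then show ?thesis
      using \<open>d > 0\<close> by (intro mult_left_mono) simp_all
  qed
  finally show "\<bar>x\<bar> ^ n \<le> (1 / d) ^ n * exp (e * \<bar>x\<bar>)" .
qed

text \<open>According to the sign of x, one summand on the right already equals the left side. A
  two-sided exponential weight is thus controlled by two members of the family.\<close>

lemma exp_abs_le_sum:
  fixes t d x :: real
  shows "exp (t * x) * exp (d * \<bar>x\<bar>) \<le> exp ((t + d) * x) + exp ((t - d) * x)"
  by (cases "x \<ge> 0") (simp_all add: exp_add[symmetric] algebra_simps)

section \<open>Moments of the exponential family and their derivatives\<close>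

context regular_nef
begin

text \<open>Left unnormalised, so that on \<open>nat_params \<nu>\<close> differentiation in
  \<open>\<theta>\<close> only raises n: this is the n-th derivative of the Laplace
  transform.\<close>

definition moment :: "nat \<Rightarrow> real \<Rightarrow> real" where
  "moment n \<theta> = (LINT x|\<nu>. x ^ n * exp (\<theta> * x))"

lemma measurable_nef [measurable_cong]: "sets \<nu> = sets borel"
  by (rule sets_borel)

text \<open>Openness leaves room for \<open>\<theta> + 2 * d\<close> and
  \<open>\<theta> - 2 * d\<close>. One factor exp(d |x|) absorbs the power; the other is kept in the
  integrand, where it later dominates a Taylor remainder for |h| < d. The same d serves every
  n.\<close>

lemma integrable_power_exp_abs:
  assumes "\<theta> \<in> nat_params \<nu>"
  obtains d where "d > 0" "\<And>n. integrable \<nu> (\<lambda>x. \<bar>x\<bar> ^ n * (exp (\<theta> * x) * exp (d * \<bar>x\<bar>)))"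
proof -
  obtain e where e: "e > 0" "ball \<theta> e \<subseteq> nat_params \<nu>"
    using open_nat_params assms open_contains_ball by blast
  \<comment> \<open>This keeps \<open>2 * d\<close> below the radius e.\<close>
  define d where "d = e / 4"
  have "\<theta> + 2 * d \<in> nat_params \<nu>" "\<theta> - 2 * d \<in> nat_params \<nu>"
    using e by (auto simp: d_def dist_real_def intro!: subsetD[OF e(2)])
  then have int: "integrable \<nu> (\<lambda>x. exp ((\<theta> + 2 * d) * x) + exp ((\<theta> - 2 * d) * x))"
    by (auto simp: nat_params_def)
  show thesis
  proof
    show "d > 0"
      using e by (simp add: d_def)
    fix n
    obtain C where C: "C \<ge> 0" "\<And>x :: real. \<bar>x\<bar> ^ n \<le> C * exp (d * \<bar>x\<bar>)"
      using abs_power_le_exp[OF \<open>d > 0\<close>] by blast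
    show "integrable \<nu> (\<lambda>x. \<bar>x\<bar> ^ n * (exp (\<theta> * x) * exp (d * \<bar>x\<bar>)))"
    proof (rule Bochner_Integration.integrable_bound[OF integrable_mult_right[OF int, of C]])
      show "AE x in \<nu>. norm (\<bar>x\<bar> ^ n * (exp (\<theta> * x) * exp (d * \<bar>x\<bar>)))
          \<le> norm (C * (exp ((\<theta> + 2 * d) * x) + exp ((\<theta> - 2 * d) * x)))"
      proof (rule AE_I2)
        fix x :: real
        have "\<bar>x\<bar> ^ n * (exp (\<theta> * x) * exp (d * \<bar>x\<bar>))
            \<le> C * exp (d * \<bar>x\<bar>) * (exp (\<theta> * x) * exp (d * \<bar>x\<bar>))"
          using C by (intro mult_right_mono) auto
        also have "\<dots> = C * (exp (\<theta> * x) * exp ((2 * d) * \<bar>x\<bar>))"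
          by (simp add: exp_add[symmetric] algebra_simps)
        also have "\<dots> \<le> C * (exp ((\<theta> + 2 * d) * x) + exp ((\<theta> - 2 * d) * x))"
          using C by (intro mult_left_mono exp_abs_le_sum)
        finally show "norm (\<bar>x\<bar> ^ n * (exp (\<theta> * x) * exp (d * \<bar>x\<bar>)))
          \<le> norm (C * (exp ((\<theta> + 2 * d) * x) + exp ((\<theta> - 2 * d) * x)))"
          using C by (simp add: abs_mult)
      qed
    qed measurable
  qed
qed

lemma integrable_moment:
  assumes "\<theta> \<in> nat_params \<nu>"
  shows "integrable \<nu> (\<lambda>x. x ^ n * exp (\<theta> * x))"
proof -
  obtain d where d: "d > 0" "\<And>n. integrable \<nu> (\<lambda>x. \<bar>x\<bar> ^ n * (exp (\<theta> * x) * exp (d * \<bar>x\<bar>)))"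
    using integrable_power_exp_abs[OF assms] by blast
  show ?thesis
  proof (rule Bochner_Integration.integrable_bound[OF d(2)[of n]])
    show "AE x in \<nu>. norm (x ^ n * exp (\<theta> * x)) \<le> norm (\<bar>x\<bar> ^ n * (exp (\<theta> * x) * exp (d * \<bar>x\<bar>)))"
    proof (rule AE_I2)
      fix x :: real
      have "\<bar>x\<bar> ^ n * exp (\<theta> * x) * 1 \<le> \<bar>x\<bar> ^ n * exp (\<theta> * x) * exp (d * \<bar>x\<bar>)"
        using d by (intro mult_left_mono) auto
      then show "norm (x ^ n * exp (\<theta> * x)) \<le> norm (\<bar>x\<bar> ^ n * (exp (\<theta> * x) * exp (d * \<bar>x\<bar>)))"
        by (simp add: abs_mult power_abs mult.assoc)
    qed
  qed measurable
qed

text \<open>The remainder of exp(h x) after the linear term is at most exp(d |x|) (h x)^2 for |h| <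
  d. Its weighted integral is finite, and C does not depend on h.\<close>

lemma moment_Taylor:
  assumes "\<theta> \<in> nat_params \<nu>"
  obtains d C where "d > 0"
    "\<And>h. \<lbrakk>\<bar>h\<bar> < d; \<theta> + h \<in> nat_params \<nu>\<rbrakk> \<Longrightarrow> \<bar>moment n (\<theta> + h) - moment n \<theta> - h * moment (Suc n) \<theta>\<bar> \<le> C * h\<^sup>2"
proof -
  obtain d where d: "d > 0" "\<And>n. integrable \<nu> (\<lambda>x. \<bar>x\<bar> ^ n * (exp (\<theta> * x) * exp (d * \<bar>x\<bar>)))"
    using integrable_power_exp_abs[OF assms] by blast
  define C where "C = (LINT x|\<nu>. \<bar>x\<bar> ^ (n + 2) * (exp (\<theta> * x) * exp (d * \<bar>x\<bar>)))"
  show thesis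
  proof (rule that[OF \<open>d > 0\<close>])
    fix h assume h: "\<bar>h\<bar> < d" and mem: "\<theta> + h \<in> nat_params \<nu>"
    let ?r = "\<lambda>x. x ^ n * exp ((\<theta> + h) * x) - x ^ n * exp (\<theta> * x) - h * (x ^ Suc n * exp (\<theta> * x))"
    have int: "integrable \<nu> ?r"
      using integrable_moment[OF mem, of n] integrable_moment[OF assms, of n]
        integrable_moment[OF assms, of "Suc n"]
      by (intro Bochner_Integration.integrable_diff integrable_mult_right) auto
    have eq: "moment n (\<theta> + h) - moment n \<theta> - h * moment (Suc n) \<theta> = integral\<^sup>L \<nu> ?r"
      unfolding moment_def
      using integrable_moment[OF mem, of n] integrable_moment[OF assms, of n]
        integrable_moment[OF assms, of "Suc n"]
      by (simp del: power_Suc)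
    have "\<bar>integral\<^sup>L \<nu> ?r\<bar> \<le> (LINT x|\<nu>. \<bar>?r x\<bar>)"
      by (rule integral_abs_bound)
    also have "\<dots> \<le> (LINT x|\<nu>. h\<^sup>2 * (\<bar>x\<bar> ^ (n + 2) * (exp (\<theta> * x) * exp (d * \<bar>x\<bar>))))"
    proof (rule integral_mono)
      show "integrable \<nu> (\<lambda>x. \<bar>?r x\<bar>)"
        by (rule integrable_abs[OF int])
      show "integrable \<nu> (\<lambda>x. h\<^sup>2 * (\<bar>x\<bar> ^ (n + 2) * (exp (\<theta> * x) * exp (d * \<bar>x\<bar>))))"
        using d(2)[of "n + 2"] by (rule integrable_mult_right)
      fix x :: real
      have "\<bar>exp (h * x) - (1 + h * x)\<bar> \<le> exp \<bar>h * x\<bar> * \<bar>h * x\<bar>\<^sup>2"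
        using Taylor_exp_field[of "h * x" 1] by (simp add: power2_eq_square)
      also have "\<dots> \<le> exp (d * \<bar>x\<bar>) * \<bar>h * x\<bar>\<^sup>2"
        using h by (intro mult_right_mono) (auto simp: abs_mult intro!: mult_right_mono)
      finally have "\<bar>x\<bar> ^ n * exp (\<theta> * x) * \<bar>exp (h * x) - (1 + h * x)\<bar>
          \<le> \<bar>x\<bar> ^ n * exp (\<theta> * x) * (exp (d * \<bar>x\<bar>) * \<bar>h * x\<bar>\<^sup>2)"
        by (intro mult_left_mono) auto
      moreover have "?r x = x ^ n * exp (\<theta> * x) * (exp (h * x) - (1 + h * x))"
        by (simp add: exp_add algebra_simps)
      then have "\<bar>?r x\<bar> = \<bar>x\<bar> ^ n * exp (\<theta> * x) * \<bar>exp (h * x) - (1 + h * x)\<bar>"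
        by (simp only: abs_mult power_abs abs_exp_cancel)
      moreover have "\<bar>x\<bar> ^ n * exp (\<theta> * x) * (exp (d * \<bar>x\<bar>) * \<bar>h * x\<bar>\<^sup>2)
          = h\<^sup>2 * (\<bar>x\<bar> ^ (n + 2) * (exp (\<theta> * x) * exp (d * \<bar>x\<bar>)))"
        by (simp only: abs_mult power_mult_distrib power_add power2_abs mult_ac)
      ultimately show "\<bar>?r x\<bar> \<le> h\<^sup>2 * (\<bar>x\<bar> ^ (n + 2) * (exp (\<theta> * x) * exp (d * \<bar>x\<bar>)))"
        by (simp only:)
    qed
    also have "\<dots> = C * h\<^sup>2"
      unfolding C_def by simp
    finally show "\<bar>moment n (\<theta> + h) - moment n \<theta> - h * moment (Suc n) \<theta>\<bar> \<le> C * h\<^sup>2"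
      unfolding eq .
  qed
qed

text \<open>A quadratic remainder leaves an error of at most C |h| in the difference
  quotient.\<close>

lemma DERIV_moment:
  assumes "\<theta> \<in> nat_params \<nu>"
  shows "(moment n has_real_derivative moment (Suc n) \<theta>) (at \<theta>)"
proof -
  obtain d C where d: "d > 0"
    "\<And>h. \<lbrakk>\<bar>h\<bar> < d; \<theta> + h \<in> nat_params \<nu>\<rbrakk> \<Longrightarrow> \<bar>moment n (\<theta> + h) - moment n \<theta> - h * moment (Suc n) \<theta>\<bar> \<le> C * h\<^sup>2"
    using moment_Taylor[OF assms] by blast
  obtain e where e: "e > 0" "ball \<theta> e \<subseteq> nat_params \<nu>"
    using open_nat_params assms open_contains_ball by blast
  have "((\<lambda>h. (moment n (\<theta> + h) - moment n \<theta>) / h - moment (Suc n) \<theta>) \<longlongrightarrow> 0) (at 0)"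
  proof (rule Lim_null_comparison)
    show "\<forall>\<^sub>F h in at 0. norm ((moment n (\<theta> + h) - moment n \<theta>) / h - moment (Suc n) \<theta>) \<le> C * \<bar>h\<bar>"
      unfolding eventually_at
    \<comment> \<open>The radius e keeps \<open>\<theta> + h\<close> among the natural parameters,
      and d makes the remainder bound available.\<close>
    proof (intro exI[of _ "min d e"] conjI ballI impI)
      fix h :: real assume h: "h \<noteq> 0 \<and> dist h 0 < min d e"
      then have "\<theta> + h \<in> nat_params \<nu>"
        by (intro subsetD[OF e(2)]) (auto simp: dist_real_def)
      then have "\<bar>moment n (\<theta> + h) - moment n \<theta> - h * moment (Suc n) \<theta>\<bar> \<le> C * h\<^sup>2"
        using h by (intro d(2)) auto
      then have "\<bar>moment n (\<theta> + h) - moment n \<theta> - h * moment (Suc n) \<theta>\<bar> / \<bar>h\<bar> \<le> C * h\<^sup>2 / \<bar>h\<bar>"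
        by (intro divide_right_mono) auto
      moreover have "C * h\<^sup>2 / \<bar>h\<bar> = C * \<bar>h\<bar>"
        using h by (simp add: field_simps power2_eq_square)
      moreover have "(moment n (\<theta> + h) - moment n \<theta>) / h - moment (Suc n) \<theta>
          = (moment n (\<theta> + h) - moment n \<theta> - h * moment (Suc n) \<theta>) / h"
        using h by (simp add: field_simps)
      ultimately show "norm ((moment n (\<theta> + h) - moment n \<theta>) / h - moment (Suc n) \<theta>) \<le> C * \<bar>h\<bar>"
        by (simp only: real_norm_def abs_divide)
    qed (use d e in auto)
    show "((\<lambda>h. C * \<bar>h\<bar>) \<longlongrightarrow> 0) (at 0)"
      by (auto intro!: tendsto_eq_intros)
  qed
  then show ?thesis
    unfolding DERIV_def using LIM_zero_iff by blast
qed

section \<open>The mean map and its inverse\<close>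

text \<open>An exponential with intermediate parameter is dominated by the sum of those at the
  endpoints. Monotonicity of the mean follows from a positive derivative only along a whole segment
  of parameters.\<close>

lemma is_interval_nat_params: "is_interval (nat_params \<nu>)"
  unfolding is_interval_1
proof (intro ballI allI impI)
  fix a b t assume ab: "a \<in> nat_params \<nu>" "b \<in> nat_params \<nu>" and t: "a \<le> t \<and> t \<le> b"
  have int: "integrable \<nu> (\<lambda>x. exp (a * x) + exp (b * x))"
    using ab by (auto simp: nat_params_def)
  have "integrable \<nu> (\<lambda>x. exp (t * x))"
  proof (rule Bochner_Integration.integrable_bound[OF int])
    show "AE x in \<nu>. norm (exp (t * x)) \<le> norm (exp (a * x) + exp (b * x))"
    proof (rule AE_I2)
      fix x :: real
      have "t * x \<le> a * x \<or> t * x \<le> b * x"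
        using t by (cases "x \<ge> 0") (auto intro: mult_right_mono mult_right_mono_neg)
      then show "norm (exp (t * x)) \<le> norm (exp (a * x) + exp (b * x))"
        by (auto intro: add_increasing add_increasing2)
    qed
  qed measurable
  then show "t \<in> nat_params \<nu>"
    by (simp add: nat_params_def)
qed

text \<open>A zero integral would make \<open>\<nu>\<close> the null measure, which is concentrated
  on the empty set and so excluded by nondegeneracy.\<close>

lemma moment_0_pos:
  assumes "\<theta> \<in> nat_params \<nu>"
  shows "moment 0 \<theta> > 0"
proof -
  have int: "integrable \<nu> (\<lambda>x. exp (\<theta> * x))"
    using assms by (simp add: nat_params_def)
  have "moment 0 \<theta> \<noteq> 0"
  proof
    assume "moment 0 \<theta> = 0"
    then have "AE x in \<nu>. x \<in> {}"
      using integral_nonneg_eq_0_iff_AE[OF int] by (simp add: moment_def)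
    then have "concentrated_on_at_most 1 \<nu>"
      unfolding concentrated_on_at_most_def by (intro exI[of _ "{}"]) simp
    then show False
      using nondegenerate by blast
  qed
  moreover have "moment 0 \<theta> \<ge> 0"
    by (simp add: moment_def)
  ultimately show ?thesis
    by simp
qed

lemma mean_of_eq:
  assumes "\<theta> \<in> nat_params \<nu>"
  shows "mean_of \<nu> \<theta> = moment 1 \<theta> / moment 0 \<theta>"
  using moment_0_pos[OF assms]
  by (simp add: mean_of_def nat_density_def cumulant_def moment_def exp_diff)

text \<open>The variance in terms of \<open>\<theta>\<close>, written with ring operations and inverses of moments only, the
  operations under which the coefficient functions below are closed.\<close>

definition mean_slope :: "real \<Rightarrow> real" where
  "mean_slope \<theta> = moment 2 \<theta> * inverse (moment 0 \<theta>)
     + (-1) * (moment 1 \<theta> * inverse (moment 0 \<theta>) * (moment 1 \<theta> * inverse (moment 0 \<theta>)))"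

text \<open>Up to the positive factor \<open>moment 0 \<theta>\<close> this is the integral of (x -
  m)^2 exp(\<open>\<theta>\<close> x), which vanishes only if \<open>\<nu>\<close> is concentrated
  on the single point m.\<close>

lemma mean_slope_pos:
  assumes "\<theta> \<in> nat_params \<nu>"
  shows "mean_slope \<theta> > 0"
proof -
  define m where "m = moment 1 \<theta> / moment 0 \<theta>"
  let ?q = "\<lambda>x. (x - m)\<^sup>2 * exp (\<theta> * x)"
  have q: "?q = (\<lambda>x. x ^ 2 * exp (\<theta> * x) - 2 * m * (x ^ 1 * exp (\<theta> * x)) + m\<^sup>2 * (x ^ 0 * exp (\<theta> * x)))"
    by (auto simp: power2_eq_square algebra_simps)
  note i = integrable_moment[OF assms]
  have int: "integrable \<nu> ?q"
    unfolding q by (intro Bochner_Integration.integrable_add Bochner_Integration.integrable_diff integrable_mult_right i)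
  have "integral\<^sup>L \<nu> ?q = moment 2 \<theta> - 2 * m * moment 1 \<theta> + m\<^sup>2 * moment 0 \<theta>"
    unfolding q moment_def using i[of 0] i[of 1] i[of 2] by simp
  also have "\<dots> = mean_slope \<theta> * moment 0 \<theta>"
    using moment_0_pos[OF assms] by (simp add: m_def mean_slope_def field_simps power2_eq_square)
  finally have eq: "integral\<^sup>L \<nu> ?q = mean_slope \<theta> * moment 0 \<theta>" .
  have "integral\<^sup>L \<nu> ?q \<noteq> 0"
  proof
    assume "integral\<^sup>L \<nu> ?q = 0"
    then have "AE x in \<nu>. x \<in> {m}"
      using integral_nonneg_eq_0_iff_AE[OF int] by simp
    then have "concentrated_on_at_most 1 \<nu>"
      unfolding concentrated_on_at_most_def by (intro exI[of _ "{m}"]) simp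
    then show False
      using nondegenerate by blast
  qed
  moreover have "integral\<^sup>L \<nu> ?q \<ge> 0"
    by simp
  ultimately show ?thesis
    using eq moment_0_pos[OF assms] by (smt (verit) mult_less_0_iff mult_eq_0_iff)
qed

text \<open>The quotient rule applied to \<open>moment 1\<close> over \<open>moment 0\<close> gives
  the variance. The quotient formula for \<open>mean_of\<close> is available on the parameter set,
  whose openness lets the derivative be transferred.\<close>

lemma DERIV_mean_of:
  assumes "\<theta> \<in> nat_params \<nu>"
  shows "(mean_of \<nu> has_real_derivative mean_slope \<theta>) (at \<theta>)"
proof -
  have "((\<lambda>\<theta>. moment 1 \<theta> / moment 0 \<theta>) has_real_derivative mean_slope \<theta>) (at \<theta>)"
    using DERIV_moment[OF assms, of 0] DERIV_moment[OF assms, of 1] moment_0_pos[OF assms]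
    by (auto intro!: derivative_eq_intros simp: mean_slope_def field_simps numeral_2_eq_2)
  then show ?thesis
    by (rule has_field_derivative_transform_within_open[OF _ open_nat_params assms])
       (simp add: mean_of_eq)
qed

lemma strict_mono_mean_of: "strict_mono_on (nat_params \<nu>) (mean_of \<nu>)"
proof (rule strict_mono_onI)
  fix a b assume ab: "a \<in> nat_params \<nu>" "b \<in> nat_params \<nu>" "a < b"
  show "mean_of \<nu> a < mean_of \<nu> b"
  proof (rule DERIV_pos_imp_increasing[OF \<open>a < b\<close>])
    fix t assume "a \<le> t" "t \<le> b"
    then have "t \<in> nat_params \<nu>"
      using is_interval_nat_params ab unfolding is_interval_1 by blast
    then show "\<exists>y. DERIV (mean_of \<nu>) t :> y \<and> y > 0"
      using DERIV_mean_of mean_slope_pos by blast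
  qed
qed

lemma inj_mean_of: "inj_on (mean_of \<nu>) (nat_params \<nu>)"
  by (rule strict_mono_on_imp_inj_on[OF strict_mono_mean_of])

lemma continuous_mean_of: "continuous_on (nat_params \<nu>) (mean_of \<nu>)"
  by (meson DERIV_mean_of DERIV_isCont continuous_at_imp_continuous_on)

text \<open>Derivatives in \<open>\<mu>\<close> depend on a whole neighbourhood; openness allows
  formulas valid on the mean domain to be differentiated there.\<close>

lemma open_mean_domain: "open (mean_domain \<nu>)"
  unfolding mean_domain_def
  by (rule invariance_of_domain[OF continuous_mean_of open_nat_params inj_mean_of])

text \<open>The natural parameter as a function of the mean, naming the inverse that occurs inside
  \<open>mean_density\<close>.\<close>

definition canonical :: "real \<Rightarrow> real" where
  "canonical = the_inv_into (nat_params \<nu>) (mean_of \<nu>)"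

lemma canonical_mem: "\<mu> \<in> mean_domain \<nu> \<Longrightarrow> canonical \<mu> \<in> nat_params \<nu>"
  unfolding canonical_def mean_domain_def by (rule the_inv_into_into[OF inj_mean_of _ subset_refl])

lemma mean_of_canonical: "\<mu> \<in> mean_domain \<nu> \<Longrightarrow> mean_of \<nu> (canonical \<mu>) = \<mu>"
  unfolding canonical_def mean_domain_def by (rule f_the_inv_into_f[OF inj_mean_of])

text \<open>Inverse function theorem: the derivative is the reciprocal of the variance.\<close>

lemma DERIV_canonical:
  assumes "\<mu> \<in> mean_domain \<nu>"
  shows "(canonical has_real_derivative inverse (mean_slope (canonical \<mu>))) (at \<mu>)"
proof -
  let ?t = "canonical \<mu>"
  have t: "?t \<in> nat_params \<nu>"
    by (rule canonical_mem[OF assms])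
  have "(canonical has_derivative (*) (inverse (mean_slope ?t))) (at (mean_of \<nu> ?t))"
  proof (rule has_derivative_inverse_strong[OF open_nat_params t continuous_mean_of])
    show "canonical (mean_of \<nu> x) = x" if "x \<in> nat_params \<nu>" for x
      unfolding canonical_def by (rule the_inv_into_f_f[OF inj_mean_of that])
    show "(mean_of \<nu> has_derivative (*) (mean_slope ?t)) (at ?t)"
      using DERIV_mean_of[OF t] by (simp add: has_field_derivative_def)
    show "(*) (mean_slope ?t) \<circ> (*) (inverse (mean_slope ?t)) = id"
      using mean_slope_pos[OF t] by (auto simp: fun_eq_iff)
  qed
  then show ?thesis
    by (simp add: has_field_derivative_def mean_of_canonical[OF assms])
qed

lemma mean_density_eq:
  assumes "\<mu> \<in> mean_domain \<nu>"
  shows "mean_density \<nu> x \<mu> = exp (canonical \<mu> * x) * inverse (moment 0 (canonical \<mu>))"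
  using moment_0_pos[OF canonical_mem[OF assms]]
  by (simp add: mean_density_def canonical_def nat_density_def cumulant_def moment_def exp_diff divide_inverse)

section \<open>Coefficient functions closed under differentiation\<close>

text \<open>A ring of functions of \<open>\<theta>\<close> that is closed under differentiation, standing in for
  \<open>C\<^sup>\<infinity>\<close> functions.\<close>

inductive_set smooth_coeffs :: "(real \<Rightarrow> real) set" where
  const: "(\<lambda>_. c) \<in> smooth_coeffs"
| moment: "moment n \<in> smooth_coeffs"
| add: "\<lbrakk>a \<in> smooth_coeffs; b \<in> smooth_coeffs\<rbrakk> \<Longrightarrow> (\<lambda>\<theta>. a \<theta> + b \<theta>) \<in> smooth_coeffs"
| mult: "\<lbrakk>a \<in> smooth_coeffs; b \<in> smooth_coeffs\<rbrakk> \<Longrightarrow> (\<lambda>\<theta>. a \<theta> * b \<theta>) \<in> smooth_coeffs"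
| inv: "\<lbrakk>a \<in> smooth_coeffs; \<forall>\<theta>\<in>nat_params \<nu>. a \<theta> \<noteq> 0\<rbrakk> \<Longrightarrow> (\<lambda>\<theta>. inverse (a \<theta>)) \<in> smooth_coeffs"

text \<open>Each formation rule has a derivative rule that stays inside the set, so differentiation
  can be iterated indefinitely.\<close>

lemma smooth_coeffs_deriv:
  assumes "a \<in> smooth_coeffs"
  shows "\<exists>a'\<in>smooth_coeffs. \<forall>\<theta>\<in>nat_params \<nu>. (a has_real_derivative a' \<theta>) (at \<theta>)"
  using assms
proof induction
  case (const c)
  show ?case
    by (rule bexI[OF _ smooth_coeffs.const[of 0]]) simp
next
  case (moment n)
  show ?case
    using DERIV_moment by (intro bexI[OF _ smooth_coeffs.moment]) blast
next
  case (add a b)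
  then obtain a' b' where
    "a' \<in> smooth_coeffs" "\<forall>\<theta>\<in>nat_params \<nu>. (a has_real_derivative a' \<theta>) (at \<theta>)"
    "b' \<in> smooth_coeffs" "\<forall>\<theta>\<in>nat_params \<nu>. (b has_real_derivative b' \<theta>) (at \<theta>)"
    by blast
  then show ?case
    by (intro bexI[where x = "\<lambda>\<theta>. a' \<theta> + b' \<theta>"]) (auto intro!: smooth_coeffs.add DERIV_add)
next
  case (mult a b)
  then obtain a' b' where
    "a' \<in> smooth_coeffs" "\<forall>\<theta>\<in>nat_params \<nu>. (a has_real_derivative a' \<theta>) (at \<theta>)"
    "b' \<in> smooth_coeffs" "\<forall>\<theta>\<in>nat_params \<nu>. (b has_real_derivative b' \<theta>) (at \<theta>)"
    by blast
  then show ?case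
    using mult.hyps
    by (intro bexI[where x = "\<lambda>\<theta>. a' \<theta> * b \<theta> + b' \<theta> * a \<theta>"])
       (auto intro!: smooth_coeffs.add smooth_coeffs.mult DERIV_mult)
next
  case (inv a)
  then obtain a' where a':
    "a' \<in> smooth_coeffs" "\<forall>\<theta>\<in>nat_params \<nu>. (a has_real_derivative a' \<theta>) (at \<theta>)"
    by blast
  \<comment> \<open>The minus sign is the constant factor -1, because the set is built from
    constants, moments, sums, products and inverses.\<close>
  let ?d = "\<lambda>\<theta>. (-1) * (inverse (a \<theta>) * a' \<theta> * inverse (a \<theta>))"
  show ?case
  proof (rule bexI[where x = ?d])
    show "\<forall>\<theta>\<in>nat_params \<nu>. ((\<lambda>\<theta>. inverse (a \<theta>)) has_real_derivative ?d \<theta>) (at \<theta>)"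
      using a' inv.hyps DERIV_inverse' by fastforce
    have i: "(\<lambda>\<theta>. inverse (a \<theta>)) \<in> smooth_coeffs"
      using inv.hyps by (rule smooth_coeffs.inv)
    show "?d \<in> smooth_coeffs"
      by (rule smooth_coeffs.mult[OF smooth_coeffs.const smooth_coeffs.mult[OF smooth_coeffs.mult[OF i a'(1)] i]])
  qed
qed

lemma inverse_moment_0_smooth: "(\<lambda>\<theta>. inverse (moment 0 \<theta>)) \<in> smooth_coeffs"
  using moment_0_pos by (intro smooth_coeffs.inv smooth_coeffs.moment) force

text \<open>This is the chain rule factor that every differentiation in \<open>\<mu>\<close>
  contributes.\<close>

lemma inverse_mean_slope_smooth: "(\<lambda>\<theta>. inverse (mean_slope \<theta>)) \<in> smooth_coeffs"
proof (rule smooth_coeffs.inv)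
  note m = smooth_coeffs.mult[OF smooth_coeffs.moment inverse_moment_0_smooth]
  show "mean_slope \<in> smooth_coeffs"
    unfolding mean_slope_def[abs_def]
    by (rule smooth_coeffs.add[OF m smooth_coeffs.mult[OF smooth_coeffs.const smooth_coeffs.mult[OF m m]]])
  show "\<forall>\<theta>\<in>nat_params \<nu>. mean_slope \<theta> \<noteq> 0"
    using mean_slope_pos by force
qed

section \<open>Polynomial expansions of the density derivatives\<close>

text \<open>Abstracts from \<open>x\<^sup>j e\<^bsup>\<theta>x\<^esup>\<close> and its integral: the same coefficients differentiate the density and
  its moments, which replaces differentiation under the integral sign.\<close>

definition derivative_tower :: "(nat \<Rightarrow> real \<Rightarrow> real) \<Rightarrow> bool" where
  "derivative_tower W \<longleftrightarrow>
     (\<forall>j. \<forall>\<theta>\<in>nat_params \<nu>. (W j has_real_derivative W (Suc j) \<theta>) (at \<theta>))"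

lemma derivative_tower_power_exp: "derivative_tower (\<lambda>j \<theta>. x ^ j * exp (\<theta> * x))"
  by (auto simp: derivative_tower_def intro!: derivative_eq_intros)

text \<open>The offset q accounts for the weight \<open>x ^ q\<close> in integrals of the density
  derivatives.\<close>

lemma derivative_tower_moment: "derivative_tower (\<lambda>j. moment (j + q))"
  using DERIV_moment by (simp add: derivative_tower_def)

text \<open>The product rule turns a_j W_j into a_j' W_j + a_j W_(j+1), and the chain rule divides
  by \<open>mean_slope\<close>. The new coefficients \<open>b\<close> are fixed before
  \<open>W\<close>, so one choice serves all towers.\<close>

lemma DERIV_canonical_expansion:
  assumes a: "\<And>j. a j \<in> smooth_coeffs" and nz: "\<And>\<theta>. \<theta> \<in> nat_params \<nu> \<Longrightarrow> a k \<theta> \<noteq> 0"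
  obtains b where "\<And>j. b j \<in> smooth_coeffs" "\<And>\<theta>. \<theta> \<in> nat_params \<nu> \<Longrightarrow> b (Suc k) \<theta> \<noteq> 0"
    "\<And>W \<mu>. \<lbrakk>derivative_tower W; \<mu> \<in> mean_domain \<nu>\<rbrakk> \<Longrightarrow>
       ((\<lambda>\<mu>. \<Sum>j\<le>k. a j (canonical \<mu>) * W j (canonical \<mu>)) has_real_derivative
         (\<Sum>j\<le>Suc k. b j (canonical \<mu>) * W j (canonical \<mu>))) (at \<mu>)"
proof -
  have "\<forall>j. \<exists>a'. a' \<in> smooth_coeffs \<and> (\<forall>\<theta>\<in>nat_params \<nu>. (a j has_real_derivative a' \<theta>) (at \<theta>))"
    using smooth_coeffs_deriv[OF a] by blast
  then obtain a' where a': "\<And>j. a' j \<in> smooth_coeffs"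
    "\<And>j \<theta>. \<theta> \<in> nat_params \<nu> \<Longrightarrow> (a j has_real_derivative a' j \<theta>) (at \<theta>)"
    by metis
  define u where "u j = (if j \<le> k then a' j else (\<lambda>_. 0))" for j
  define v where "v j = (case j of 0 \<Rightarrow> (\<lambda>_. 0) | Suc i \<Rightarrow> a i)" for j
  define b where "b j \<theta> = inverse (mean_slope \<theta>) * (u j \<theta> + v j \<theta>)" for j \<theta>
  show thesis
  proof (rule that[of b])
    fix j
    have "u j \<in> smooth_coeffs"
      by (simp add: u_def a' smooth_coeffs.const)
    moreover have "v j \<in> smooth_coeffs"
      by (simp add: v_def a smooth_coeffs.const split: nat.split)
    ultimately show "b j \<in> smooth_coeffs"
      unfolding b_def[abs_def] by (intro smooth_coeffs.mult inverse_mean_slope_smooth smooth_coeffs.add)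
  next
    fix \<theta> assume "\<theta> \<in> nat_params \<nu>"
    then show "b (Suc k) \<theta> \<noteq> 0"
      using nz mean_slope_pos[of \<theta>] by (simp add: b_def u_def v_def)
  next
    fix W :: "nat \<Rightarrow> real \<Rightarrow> real" and \<mu>
    assume "derivative_tower W" and \<mu>: "\<mu> \<in> mean_domain \<nu>"
    then have W: "(W j has_real_derivative W (Suc j) \<theta>) (at \<theta>)" if "\<theta> \<in> nat_params \<nu>" for j \<theta>
      using that by (simp add: derivative_tower_def)
    let ?t = "canonical \<mu>" and ?s = "inverse (mean_slope (canonical \<mu>))"
    have t: "?t \<in> nat_params \<nu>"
      by (rule canonical_mem[OF \<mu>])
    have "((\<lambda>\<theta>. \<Sum>j\<le>k. a j \<theta> * W j \<theta>) has_real_derivative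
        (\<Sum>j\<le>k. a' j ?t * W j ?t + W (Suc j) ?t * a j ?t)) (at ?t)"
      by (intro DERIV_sum DERIV_mult a' W t)
    then have "((\<lambda>\<mu>. \<Sum>j\<le>k. a j (canonical \<mu>) * W j (canonical \<mu>)) has_real_derivative
        (\<Sum>j\<le>k. a' j ?t * W j ?t + W (Suc j) ?t * a j ?t) * ?s) (at \<mu>)"
      by (rule DERIV_chain2[OF _ DERIV_canonical[OF \<mu>]])
    moreover have "(\<Sum>j\<le>Suc k. b j ?t * W j ?t)
        = (\<Sum>j\<le>k. a' j ?t * W j ?t + W (Suc j) ?t * a j ?t) * ?s"
    proof -
      have "(\<Sum>j\<le>Suc k. b j ?t * W j ?t)
          = ?s * ((\<Sum>j\<le>Suc k. u j ?t * W j ?t) + (\<Sum>j\<le>Suc k. v j ?t * W j ?t))"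
        by (simp add: b_def sum_distrib_left sum.distrib distrib_left distrib_right mult.assoc
            del: sum.atMost_Suc)
      also have "(\<Sum>j\<le>Suc k. u j ?t * W j ?t) = (\<Sum>j\<le>k. a' j ?t * W j ?t)"
        by (simp add: u_def)
      also have "(\<Sum>j\<le>Suc k. v j ?t * W j ?t) = (\<Sum>j\<le>k. W (Suc j) ?t * a j ?t)"
        by (subst sum.atMost_Suc_shift) (simp add: v_def mult.commute)
      finally show ?thesis
        by (simp add: sum.distrib mult.commute)
    qed
    ultimately show "((\<lambda>\<mu>. \<Sum>j\<le>k. a j (canonical \<mu>) * W j (canonical \<mu>)) has_real_derivative
         (\<Sum>j\<le>Suc k. b j ?t * W j ?t)) (at \<mu>)"
      by (simp only:)
  qed
qed

text \<open>Nonvanishing of \<open>a k\<close> makes the degree in x exactly k; the independence of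
  the derivatives of different orders rests on it.\<close>

definition density_expansion :: "nat \<Rightarrow> (nat \<Rightarrow> real \<Rightarrow> real) \<Rightarrow> bool" where
  "density_expansion k a \<longleftrightarrow> (\<forall>j. a j \<in> smooth_coeffs) \<and> (\<forall>\<theta>\<in>nat_params \<nu>. a k \<theta> \<noteq> 0) \<and>
     (\<forall>\<mu>\<in>mean_domain \<nu>. \<forall>x. mean_density_deriv \<nu> k x \<mu>
        = (\<Sum>j\<le>k. a j (canonical \<mu>) * (x ^ j * exp (canonical \<mu> * x))))"

lemma density_expansion_0: "density_expansion 0 (\<lambda>_ \<theta>. inverse (moment 0 \<theta>))"
  using moment_0_pos
  by (force simp: density_expansion_def inverse_moment_0_smooth mean_density_deriv_def mean_density_eq)

text \<open>Applying the derivative rule to the tower \<open>x ^ j * exp (\<theta> * x)\<close>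
  expands the next density derivative. The rule is also handed on for arbitrary towers, since the
  moments must be differentiated with the very same \<open>b\<close>.\<close>

lemma density_expansion_Suc:
  assumes "density_expansion k a"
  obtains b where "density_expansion (Suc k) b"
    "\<And>W \<mu>. \<lbrakk>derivative_tower W; \<mu> \<in> mean_domain \<nu>\<rbrakk> \<Longrightarrow>
       ((\<lambda>\<mu>. \<Sum>j\<le>k. a j (canonical \<mu>) * W j (canonical \<mu>)) has_real_derivative
         (\<Sum>j\<le>Suc k. b j (canonical \<mu>) * W j (canonical \<mu>))) (at \<mu>)"
proof -
  note a = assms[unfolded density_expansion_def]
  obtain b where b: "\<And>j. b j \<in> smooth_coeffs" "\<And>\<theta>. \<theta> \<in> nat_params \<nu> \<Longrightarrow> b (Suc k) \<theta> \<noteq> 0"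
    "\<And>W \<mu>. \<lbrakk>derivative_tower W; \<mu> \<in> mean_domain \<nu>\<rbrakk> \<Longrightarrow>
       ((\<lambda>\<mu>. \<Sum>j\<le>k. a j (canonical \<mu>) * W j (canonical \<mu>)) has_real_derivative
         (\<Sum>j\<le>Suc k. b j (canonical \<mu>) * W j (canonical \<mu>))) (at \<mu>)"
    using DERIV_canonical_expansion[of a k] a by blast
  have D: "(mean_density_deriv \<nu> k x has_real_derivative
      (\<Sum>j\<le>Suc k. b j (canonical \<mu>) * (x ^ j * exp (canonical \<mu> * x)))) (at \<mu>)"
    if \<mu>: "\<mu> \<in> mean_domain \<nu>" for x \<mu>
  proof (rule has_field_derivative_transform_within_open[OF _ open_mean_domain \<mu>])
    show "((\<lambda>\<mu>. \<Sum>j\<le>k. a j (canonical \<mu>) * (x ^ j * exp (canonical \<mu> * x))) has_real_derivative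
        (\<Sum>j\<le>Suc k. b j (canonical \<mu>) * (x ^ j * exp (canonical \<mu> * x)))) (at \<mu>)"
      by (rule b(3)[OF derivative_tower_power_exp \<mu>])
    show "(\<Sum>j\<le>k. a j (canonical m) * (x ^ j * exp (canonical m * x))) = mean_density_deriv \<nu> k x m"
      if "m \<in> mean_domain \<nu>" for m
      using a that by simp
  qed
  have eq: "mean_density_deriv \<nu> (Suc k) x \<mu> = (\<Sum>j\<le>Suc k. b j (canonical \<mu>) * (x ^ j * exp (canonical \<mu> * x)))"
    if "\<mu> \<in> mean_domain \<nu>" for x \<mu>
    using DERIV_imp_deriv[OF D[OF that]] by (simp add: mean_density_deriv_def)
  show thesis
  proof (rule that[of b])
    show "density_expansion (Suc k) b"
      unfolding density_expansion_def using b(1,2) eq by blast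
  qed (rule b(3))
qed

lemma ex_density_expansion: "\<exists>a. density_expansion k a"
proof (induction k)
  case 0
  show ?case
    using density_expansion_0 by blast
next
  case (Suc k)
  then show ?case
    using density_expansion_Suc by metis
qed

section \<open>Mass and first moment of the density derivatives\<close>

lemma has_bochner_integral_density_expansion:
  assumes "density_expansion k a" and "\<mu> \<in> mean_domain \<nu>"
  shows "has_bochner_integral \<nu> (\<lambda>x. x ^ q * mean_density_deriv \<nu> k x \<mu>)
    (\<Sum>j\<le>k. a j (canonical \<mu>) * moment (j + q) (canonical \<mu>))"
proof -
  have "has_bochner_integral \<nu> (\<lambda>x. \<Sum>j\<le>k. a j (canonical \<mu>) * (x ^ (j + q) * exp (canonical \<mu> * x)))
    (\<Sum>j\<le>k. a j (canonical \<mu>) * moment (j + q) (canonical \<mu>))"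
    unfolding moment_def
    by (intro has_bochner_integral_sum has_bochner_integral_mult_right has_bochner_integral_integrable
        integrable_moment canonical_mem assms)
  moreover have "x ^ q * mean_density_deriv \<nu> k x \<mu>
      = (\<Sum>j\<le>k. a j (canonical \<mu>) * (x ^ (j + q) * exp (canonical \<mu> * x)))" for x
    using assms by (simp add: density_expansion_def sum_distrib_left power_add mult_ac)
  ultimately show ?thesis
    by simp
qed

lemma integrable_density_deriv:
  "\<mu> \<in> mean_domain \<nu> \<Longrightarrow> integrable \<nu> (\<lambda>x. x ^ q * mean_density_deriv \<nu> k x \<mu>)"
  using ex_density_expansion has_bochner_integral_density_expansion has_bochner_integral_iff by blast

text \<open>Both integrals are finite combinations of moments, with coefficients \<open>a\<close>
  and \<open>b\<close>; the rule linking \<open>a\<close> to \<open>b\<close>, applied to the moment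
  tower, is the claim.\<close>

lemma DERIV_integral_density_deriv:
  assumes "\<mu> \<in> mean_domain \<nu>"
  shows "((\<lambda>\<mu>. LINT x|\<nu>. x ^ q * mean_density_deriv \<nu> k x \<mu>) has_real_derivative
    (LINT x|\<nu>. x ^ q * mean_density_deriv \<nu> (Suc k) x \<mu>)) (at \<mu>)"
proof -
  obtain a where a: "density_expansion k a"
    using ex_density_expansion by blast
  obtain b where b: "density_expansion (Suc k) b"
    "\<And>W \<mu>. \<lbrakk>derivative_tower W; \<mu> \<in> mean_domain \<nu>\<rbrakk> \<Longrightarrow>
       ((\<lambda>\<mu>. \<Sum>j\<le>k. a j (canonical \<mu>) * W j (canonical \<mu>)) has_real_derivative
         (\<Sum>j\<le>Suc k. b j (canonical \<mu>) * W j (canonical \<mu>))) (at \<mu>)"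
    using density_expansion_Suc[OF a] by blast
  have int: "(LINT x|\<nu>. x ^ q * mean_density_deriv \<nu> k x m)
      = (\<Sum>j\<le>k. a j (canonical m) * moment (j + q) (canonical m))" if "m \<in> mean_domain \<nu>" for m
    by (rule has_bochner_integral_integral_eq[OF has_bochner_integral_density_expansion[OF a that]])
  show ?thesis
    unfolding has_bochner_integral_integral_eq[OF has_bochner_integral_density_expansion[OF b(1) assms]]
    by (rule has_field_derivative_transform_within_open
          [OF b(2)[OF derivative_tower_moment assms] open_mean_domain assms])
       (simp add: int)
qed

lemma integral_density_deriv_Suc:
  assumes const: "\<And>m. m \<in> mean_domain \<nu> \<Longrightarrow> (LINT x|\<nu>. x ^ q * mean_density_deriv \<nu> k x m) = c"
    and "\<mu> \<in> mean_domain \<nu>"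
  shows "(LINT x|\<nu>. x ^ q * mean_density_deriv \<nu> (Suc k) x \<mu>) = 0"
proof (rule DERIV_unique[OF DERIV_integral_density_deriv[OF assms(2)]])
  show "((\<lambda>\<mu>. LINT x|\<nu>. x ^ q * mean_density_deriv \<nu> k x \<mu>) has_real_derivative 0) (at \<mu>)"
    by (rule has_field_derivative_transform_within_open[OF DERIV_const open_mean_domain assms(2)])
       (simp add: const)
qed

lemma integral_density:
  assumes "\<mu> \<in> mean_domain \<nu>"
  shows "(LINT x|\<nu>. mean_density \<nu> x \<mu>) = 1" "(LINT x|\<nu>. x * mean_density \<nu> x \<mu>) = \<mu>"
proof -
  have t: "canonical \<mu> \<in> nat_params \<nu>"
    by (rule canonical_mem[OF assms])
  show "(LINT x|\<nu>. mean_density \<nu> x \<mu>) = 1"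
    using moment_0_pos[OF t] by (simp add: mean_density_eq[OF assms] moment_def)
  have "(LINT x|\<nu>. x * mean_density \<nu> x \<mu>) = mean_of \<nu> (canonical \<mu>)"
    by (simp add: mean_of_def mean_density_def canonical_def)
  then show "(LINT x|\<nu>. x * mean_density \<nu> x \<mu>) = \<mu>"
    by (simp add: mean_of_canonical[OF assms])
qed

lemma integral_density_deriv:
  assumes "\<mu> \<in> mean_domain \<nu>" "k \<ge> 1"
  shows "(LINT x|\<nu>. mean_density_deriv \<nu> k x \<mu>) = 0"
  using assms(2,1)
proof (induction k arbitrary: \<mu> rule: dec_induct)
  case base
  show ?case
    using integral_density_deriv_Suc[of 0 0 1] base integral_density(1)
    by (simp add: mean_density_deriv_def)
next
  case (step k)
  then show ?case
    using integral_density_deriv_Suc[of 0 k 0] by simp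
qed

text \<open>The first moment of f is \<open>\<mu>\<close>, so its first derivative in
  \<open>\<mu>\<close> is 1 and all later ones are 0. This is where starting the mixture at order 2
  matters.\<close>

lemma integral_times_density_deriv:
  assumes "\<mu> \<in> mean_domain \<nu>" "k \<ge> 2"
  shows "(LINT x|\<nu>. x * mean_density_deriv \<nu> k x \<mu>) = 0"
proof -
  have 1: "(LINT x|\<nu>. x ^ 1 * mean_density_deriv \<nu> 1 x m) = 1" if "m \<in> mean_domain \<nu>" for m
  proof (rule DERIV_unique)
    show "((\<lambda>\<mu>. LINT x|\<nu>. x ^ 1 * mean_density_deriv \<nu> 0 x \<mu>) has_real_derivative
        (LINT x|\<nu>. x ^ 1 * mean_density_deriv \<nu> 1 x m)) (at m)"
      using DERIV_integral_density_deriv[OF that, of 1 0] by simp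
    show "((\<lambda>\<mu>. LINT x|\<nu>. x ^ 1 * mean_density_deriv \<nu> 0 x \<mu>) has_real_derivative 1) (at m)"
      by (rule has_field_derivative_transform_within_open[OF DERIV_ident open_mean_domain that])
         (simp add: mean_density_deriv_def integral_density)
  qed
  show ?thesis
    using assms(2,1)
  proof (induction k arbitrary: \<mu> rule: dec_induct)
    case base
    show ?case
      using integral_density_deriv_Suc[of 1 1 1, OF 1] base by (simp add: numeral_2_eq_2)
  next
    case (step k)
    then show ?case
      using integral_density_deriv_Suc[of 1 k 0] by simp
  qed
qed

section \<open>Identification of the mean and of the weights\<close>

lemma integral_times_local_mixture:
  assumes "\<mu> \<in> mean_domain \<nu>"
  shows "(LINT x|\<nu>. x * local_mixture \<nu> r x \<mu> l) = \<mu>"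
proof -
  have i: "integrable \<nu> (\<lambda>x. x * mean_density_deriv \<nu> k x \<mu>)" for k
    using integrable_density_deriv[OF assms, of 1 k] by simp
  have "(LINT x|\<nu>. x * local_mixture \<nu> r x \<mu> l)
      = (LINT x|\<nu>. x * mean_density_deriv \<nu> 0 x \<mu> + (\<Sum>k=2..r. l k * (x * mean_density_deriv \<nu> k x \<mu>)))"
    by (simp add: local_mixture_def mean_density_deriv_def distrib_left sum_distrib_left mult.left_commute)
  also have "\<dots> = (LINT x|\<nu>. x * mean_density_deriv \<nu> 0 x \<mu>)
      + (\<Sum>k=2..r. l k * (LINT x|\<nu>. x * mean_density_deriv \<nu> k x \<mu>))"
    using i by simp
  also have "(\<Sum>k=2..r. l k * (LINT x|\<nu>. x * mean_density_deriv \<nu> k x \<mu>)) = 0"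
    using assms by (simp add: integral_times_density_deriv)
  also have "(LINT x|\<nu>. x * mean_density_deriv \<nu> 0 x \<mu>) + 0 = \<mu>"
    using assms by (simp add: integral_density mean_density_deriv_def)
  finally show ?thesis .
qed

text \<open>Mixtures that agree almost everywhere have the same first moment, which is the parameter
  itself.\<close>

lemma local_mixture_mean_identified:
  assumes "\<mu> \<in> mean_domain \<nu>" "\<mu>' \<in> mean_domain \<nu>"
    and "AE x in \<nu>. local_mixture \<nu> r x \<mu> l = local_mixture \<nu> r x \<mu>' l'"
  shows "\<mu> = \<mu>'"
proof -
  have meas: "(\<lambda>x. x * local_mixture \<nu> r x m c) \<in> borel_measurable \<nu>" if "m \<in> mean_domain \<nu>" for m c
  proof -
    have "(\<lambda>x. mean_density_deriv \<nu> k x m) \<in> borel_measurable \<nu>" for k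
      using square_integrable[OF that] by (simp add: in_L2_def)
    moreover from this[of 0] have "(\<lambda>x. mean_density \<nu> x m) \<in> borel_measurable \<nu>"
      by (simp add: mean_density_deriv_def)
    ultimately show ?thesis
      unfolding local_mixture_def by measurable
  qed
  have "(LINT x|\<nu>. x * local_mixture \<nu> r x \<mu> l) = (LINT x|\<nu>. x * local_mixture \<nu> r x \<mu>' l')"
    using assms by (intro integral_cong_AE meas) auto
  then show ?thesis
    using assms by (simp add: integral_times_local_mixture)
qed

text \<open>The expansions are triangular in the degree. At the largest index K where the weights
  differ, \<open>x ^ K\<close> has a nonzero coefficient in the difference, so the difference
  vanishes on at most r points; yet it vanishes almost everywhere.\<close>

lemma local_mixture_weights_identified:
  assumes \<mu>: "\<mu> \<in> mean_domain \<nu>" and conc: "\<not> concentrated_on_at_most r \<nu>"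
    and ae: "AE x in \<nu>. local_mixture \<nu> r x \<mu> l = local_mixture \<nu> r x \<mu> l'"
    and k: "k \<in> {2..r}"
  shows "l k = l' k"
proof (rule ccontr)
  assume neq: "l k \<noteq> l' k"
  obtain a where a: "\<And>k. density_expansion k (a k)"
    using ex_density_expansion by metis
  \<comment> \<open>Padding by zero above the degree lets all expansions be summed over the common
    range j <= r.\<close>
  define c where "c k j = (if j \<le> k then a k j (canonical \<mu>) else 0)" for k j
  define K where "K = Max {k\<in>{2..r}. l k \<noteq> l' k}"
  have "K \<in> {k\<in>{2..r}. l k \<noteq> l' k}"
    unfolding K_def using k neq by (intro Max_in) auto
  then have K: "K \<le> r" "K \<in> {2..r}" "l K \<noteq> l' K"
    by auto
  have above: "l i = l' i" if "i \<in> {2..r}" "i > K" for i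
    using Max_ge[of "{k\<in>{2..r}. l k \<noteq> l' k}" i] that unfolding K_def[symmetric] by auto
  have expand: "mean_density_deriv \<nu> i x \<mu> = (\<Sum>j\<le>r. c i j * x ^ j) * exp (canonical \<mu> * x)" if "i \<le> r" for i x
  proof -
    have "mean_density_deriv \<nu> i x \<mu> = (\<Sum>j\<le>i. c i j * x ^ j) * exp (canonical \<mu> * x)"
      using a \<mu> by (simp add: density_expansion_def c_def sum_distrib_right mult.assoc)
    also have "(\<Sum>j\<le>i. c i j * x ^ j) = (\<Sum>j\<le>r. c i j * x ^ j)"
      using that by (intro sum.mono_neutral_left) (auto simp: c_def)
    finally show ?thesis .
  qed
  define w where "w j = (\<Sum>i=2..r. (l i - l' i) * c i j)" for j
  have diff: "local_mixture \<nu> r x \<mu> l - local_mixture \<nu> r x \<mu> l'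
      = (\<Sum>j\<le>r. w j * x ^ j) * exp (canonical \<mu> * x)" for x
  proof -
    have "local_mixture \<nu> r x \<mu> l - local_mixture \<nu> r x \<mu> l'
        = (\<Sum>i=2..r. (l i - l' i) * mean_density_deriv \<nu> i x \<mu>)"
      by (simp add: local_mixture_def sum_subtractf left_diff_distrib)
    also have "\<dots> = (\<Sum>i=2..r. \<Sum>j\<le>r. (l i - l' i) * c i j * x ^ j) * exp (canonical \<mu> * x)"
      by (simp add: expand sum_distrib_left sum_distrib_right mult.assoc)
    also have "(\<Sum>i=2..r. \<Sum>j\<le>r. (l i - l' i) * c i j * x ^ j) = (\<Sum>j\<le>r. w j * x ^ j)"
      by (subst sum.swap) (simp add: w_def sum_distrib_right)
    finally show ?thesis .
  qed
  \<comment> \<open>Orders below K have no term of degree K, and above K the weights agree.\<close>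
  have "w K = (\<Sum>i\<in>{K}. (l i - l' i) * c i K)"
    unfolding w_def using K above by (intro sum.mono_neutral_right) (auto simp: c_def not_le)
  moreover have "c K K \<noteq> 0"
    using a[of K] canonical_mem[OF \<mu>] by (simp add: c_def density_expansion_def)
  ultimately have "w K \<noteq> 0"
    using K by simp
  then have roots: "finite {x. (\<Sum>j\<le>r. w j * x ^ j) = 0} \<and> card {x. (\<Sum>j\<le>r. w j * x ^ j) = 0} \<le> r"
    using K(1) by (intro polyfun_rootbound) blast
  have "AE x in \<nu>. x \<in> {x. (\<Sum>j\<le>r. w j * x ^ j) = 0}"
    using ae
  proof (rule AE_mp, intro AE_I2 impI)
    fix x assume "local_mixture \<nu> r x \<mu> l = local_mixture \<nu> r x \<mu> l'"
    then show "x \<in> {x. (\<Sum>j\<le>r. w j * x ^ j) = 0}"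
      using diff[of x] by simp
  qed
  then show False
    using conc roots unfolding concentrated_on_at_most_def by blast
qed

section \<open>Scores at zero weights and their orthogonality\<close>

lemma mean_density_pos: "mean_density \<nu> x \<mu> > 0"
  by (simp add: mean_density_def nat_density_def)

text \<open>In the natural parameter the log-density
  \<open>\<theta> * x - ln (moment 0 \<theta>)\<close> has derivative x minus the mean; the chain
  rule divides by the variance.\<close>

lemma mean_score:
  assumes "\<mu> \<in> mean_domain \<nu>"
  shows "deriv (\<lambda>m. ln (local_mixture \<nu> r x m (\<lambda>_. 0))) \<mu> = (x - \<mu>) / mean_slope (canonical \<mu>)"
proof -
  let ?t = "canonical \<mu>"
  have t: "?t \<in> nat_params \<nu>"
    by (rule canonical_mem[OF assms])
  have "((\<lambda>\<theta>. \<theta> * x - ln (moment 0 \<theta>)) has_real_derivative x - mean_of \<nu> ?t) (at ?t)"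
    using moment_0_pos[OF t] DERIV_moment[OF t, of 0]
    by (auto intro!: derivative_eq_intros simp: mean_of_eq[OF t])
  then have "((\<lambda>m. canonical m * x - ln (moment 0 (canonical m))) has_real_derivative
      (x - \<mu>) * inverse (mean_slope ?t)) (at \<mu>)"
    using DERIV_chain2[OF _ DERIV_canonical[OF assms]] by (simp add: mean_of_canonical[OF assms])
  then have "((\<lambda>m. ln (local_mixture \<nu> r x m (\<lambda>_. 0))) has_real_derivative
      (x - \<mu>) * inverse (mean_slope ?t)) (at \<mu>)"
  proof (rule has_field_derivative_transform_within_open[OF _ open_mean_domain assms])
    fix m assume m: "m \<in> mean_domain \<nu>"
    show "canonical m * x - ln (moment 0 (canonical m)) = ln (local_mixture \<nu> r x m (\<lambda>_. 0))"
      using moment_0_pos[OF canonical_mem[OF m]]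
      by (simp add: local_mixture_def mean_density_eq[OF m] ln_mult ln_inverse)
  qed
  then show ?thesis
    by (simp add: DERIV_imp_deriv divide_inverse)
qed

text \<open>Along a single coordinate the mixture is affine in t, with positive value f at t = 0, so
  the logarithmic derivative there is f^(k) / f.\<close>

lemma weight_score:
  assumes "k \<in> {2..r}"
  shows "deriv (\<lambda>t. ln (local_mixture \<nu> r x \<mu> ((\<lambda>_. 0)(k := t)))) 0
    = mean_density_deriv \<nu> k x \<mu> / mean_density \<nu> x \<mu>"
proof -
  have "local_mixture \<nu> r x \<mu> ((\<lambda>_. 0)(k := t)) = mean_density \<nu> x \<mu> + t * mean_density_deriv \<nu> k x \<mu>" for t
  proof -
    have "(\<Sum>i=2..r. ((\<lambda>_. 0)(k := t)) i * mean_density_deriv \<nu> i x \<mu>)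
        = (\<Sum>i=2..r. if i = k then t * mean_density_deriv \<nu> i x \<mu> else 0)"
      by (intro sum.cong) auto
    then show ?thesis
      using assms by (simp add: local_mixture_def)
  qed
  then show ?thesis
    using mean_density_pos[of x \<mu>]
    by (auto intro!: DERIV_imp_deriv derivative_eq_intros simp: divide_inverse)
qed

text \<open>The factor f cancels the denominator of the weight score, leaving (x -
  \<open>\<mu>\<close>) f^(k) over the variance; mass and first moment of f^(k) vanish for k >= 2.
  Stating it by \<open>has_bochner_integral\<close> includes integrability, so the value 0 is not a
  default.\<close>

lemma scores_orthogonal:
  assumes \<mu>: "\<mu> \<in> mean_domain \<nu>" and k: "k \<in> {2..r}"
  shows "has_bochner_integral \<nu>
    (\<lambda>x. deriv (\<lambda>m. ln (local_mixture \<nu> r x m (\<lambda>_. 0))) \<mu>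
       * deriv (\<lambda>t. ln (local_mixture \<nu> r x \<mu> ((\<lambda>_. 0)(k := t)))) 0
       * mean_density \<nu> x \<mu>) 0"
proof -
  let ?s = "inverse (mean_slope (canonical \<mu>))"
  have "has_bochner_integral \<nu> (\<lambda>x. x * mean_density_deriv \<nu> k x \<mu>) 0"
    using integrable_density_deriv[OF \<mu>, of 1 k] integral_times_density_deriv[OF \<mu>] k
    by (simp add: has_bochner_integral_iff)
  moreover have "has_bochner_integral \<nu> (\<lambda>x. mean_density_deriv \<nu> k x \<mu>) 0"
    using integrable_density_deriv[OF \<mu>, of 0 k] integral_density_deriv[OF \<mu>] k
    by (simp add: has_bochner_integral_iff)
  ultimately have "has_bochner_integral \<nu>
      (\<lambda>x. ?s * (x * mean_density_deriv \<nu> k x \<mu>) - ?s * \<mu> * mean_density_deriv \<nu> k x \<mu>) (?s * 0 - ?s * \<mu> * 0)"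
    by (intro has_bochner_integral_diff has_bochner_integral_mult_right)
  moreover have "deriv (\<lambda>m. ln (local_mixture \<nu> r x m (\<lambda>_. 0))) \<mu>
       * deriv (\<lambda>t. ln (local_mixture \<nu> r x \<mu> ((\<lambda>_. 0)(k := t)))) 0 * mean_density \<nu> x \<mu>
     = ?s * (x * mean_density_deriv \<nu> k x \<mu>) - ?s * \<mu> * mean_density_deriv \<nu> k x \<mu>" for x
    using mean_density_pos[of x \<mu>] mean_slope_pos[OF canonical_mem[OF \<mu>]]
    by (simp add: mean_score[OF \<mu>] weight_score[OF k] field_simps)
  ultimately show ?thesis
    by simp
qed

end

text \<open>Equality almost everywhere expresses equality in L^2. The support condition is natural:
  on n <= r atoms, functions with zero mass and zero first moment form a space of dimension n - 2,
  too small for r - 1 independent derivatives. Updating the zero weights at k gives the partial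
  derivative in the k-th weight.\<close>

theorem theorem2:
  fixes \<nu> :: "real measure" and r :: nat
  assumes "regular_nef \<nu>" and "r \<ge> 2"
  shows "(\<not> concentrated_on_at_most r \<nu> \<longrightarrow>
           (\<forall>\<mu>\<in>mean_domain \<nu>. \<forall>\<mu>'\<in>mean_domain \<nu>. \<forall>l l' :: nat \<Rightarrow> real.
              (AE x in \<nu>. local_mixture \<nu> r x \<mu> l = local_mixture \<nu> r x \<mu>' l') \<longrightarrow>
              \<mu> = \<mu>' \<and> (\<forall>k\<in>{2..r}. l k = l' k)))
       \<and> ((\<exists>p :: real poly. degree p \<le> 2 \<and>
              (\<forall>\<mu>\<in>mean_domain \<nu>. variance_function \<nu> \<mu> = poly p \<mu>)) \<longrightarrow>
           (\<forall>\<mu>\<in>mean_domain \<nu>. \<forall>k\<in>{2..r}.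
              has_bochner_integral \<nu>
                (\<lambda>x. deriv (\<lambda>m. ln (local_mixture \<nu> r x m (\<lambda>_. 0))) \<mu>
                   * deriv (\<lambda>t. ln (local_mixture \<nu> r x \<mu> ((\<lambda>_. 0)(k := t)))) 0
                   * mean_density \<nu> x \<mu>) 0))"
proof -
  interpret regular_nef \<nu>
    by (rule assms(1))
  show ?thesis
    using local_mixture_mean_identified local_mixture_weights_identified scores_orthogonal
    by blast
qed

end
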